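(* Let $\mathbb{F}$ be a field, let $\mathbf{L}$ be an almost Abelian Lie algebra over $\mathbb{F}$ and let $\mathbf{L}'$ be an Abelian or almost Abelian Lie algebra over $\mathbb{F}$. Let $\mathbf{L}=\mathbf{L}_0\oplus\mathbf{W}$ with $\mathbf{L}_0$ indecomposable almost Abelian and $\mathbf{W}$ a possibly trivial Abelian Lie algebra, and let $\mathbf{L}'=\mathbf{L}_0'\oplus\mathbf{W}'$ where $\mathbf{L}_0'$ is either trivial or indecomposable almost Abelian and $\mathbf{W}'$ is a possibly trivial Abelian Lie algebra. Let $\phi:\mathbf{L}\to\mathbf{L}'$ be a surjective Lie algebra homomorphism, with block form $$\phi=\begin{pmatrix}\phi_{00}&\phi_{01}\\ \phi_{10}&\phi_{11}\end{pmatrix},\qquad \phi(X+Y)=(\phi_{00}X+\phi_{01}Y)+(\phi_{10}X+\phi_{11}Y),\quad X\in\mathbf{L}_0,\ Y\in\mathbf{W},$$ where $\phi_{00}:\mathbf{L}_0\to\mathbf{L}_0'$, $\phi_{01}:\mathbf{W}\to\mathbf{L}_0'$, $\phi_{10}:\mathbf{L}_0\to\mathbf{W}'$, $\phi_{11}:\mathbf{W}\to\mathbf{W}'$ are linear. Then: (1) $\phi_{00}$ is a surjective Lie algebra homomorphism $\mathbf{L}_0\to\mathbf{L}_0'$; (2) $\phi_{01}$ is a Lie algebra homomorphism from $\mathbf{W}$ to the centre $\mathcal{Z}(\mathbf{L}_0')$; (3) $\phi_{10}$ is a Lie algebra homomorphism $\mathbf{L}_0\to\mathbf{W}'$, i.e.,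 $[\mathbf{L}_0,\mathbf{L}_0]\subset\ker\phi_{10}$; (4) $\phi_{11}$ is a Lie algebra homomorphism $\mathbf{W}\to\mathbf{W}'$ such that $\phi_{10}\mathbf{L}_0+\phi_{11}\mathbf{W}=\mathbf{W}'$.
   Context: An almost Abelian Lie algebra over a field $\mathbb{F}$ (of arbitrary, possibly infinite, dimension) is a non-Abelian Lie algebra that contains a codimension 1 Abelian subalgebra. A Lie algebra is decomposable if it is the direct sum of two commuting nonzero Lie subalgebras; otherwise it is indecomposable. Here $\oplus$ denotes the Lie algebra direct sum. $\mathcal{Z}(\cdot)$ denotes the centre of a Lie algebra. *)

theory Defs
  imports Complex_Main "HOL-Library.Set_Algebras"
begin

text \<open>
  A Lie algebra is a whole type carrying a vector space structure (of any dimension) over an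
  arbitrary field. Its subalgebras are sets, and notions such as \<open>almost_abelian\<close> are stated for
  sets, so that they apply to the whole algebra (\<open>UNIV\<close>) and to its direct summands alike.
  The bracket is alternating, as required in characteristic 2.
\<close>

locale lie_algebra = vector_space scale
  for scale :: "'f::field \<Rightarrow> 'a::ab_group_add \<Rightarrow> 'a" +
  fixes bracket :: "'a \<Rightarrow> 'a \<Rightarrow> 'a"
  assumes bracket_add_left: "bracket (x + y) z = bracket x z + bracket y z"
    and bracket_add_right: "bracket x (y + z) = bracket x y + bracket x z"
    and bracket_scale_left: "bracket (scale c x) y = scale c (bracket x y)"
    and bracket_scale_right: "bracket x (scale c y) = scale c (bracket x y)"
    and bracket_self: "bracket x x = 0"
    and jacobi: "bracket x (bracket y z) + bracket y (bracket z x) + bracket z (bracket x y) = 0"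
begin

definition subalgebra :: "'a set \<Rightarrow> bool" where
  "subalgebra S \<longleftrightarrow> subspace S \<and> (\<forall>x\<in>S. \<forall>y\<in>S. bracket x y \<in> S)"

definition commuting :: "'a set \<Rightarrow> 'a set \<Rightarrow> bool" where
  "commuting A B \<longleftrightarrow> (\<forall>x\<in>A. \<forall>y\<in>B. bracket x y = 0)"

definition abelian :: "'a set \<Rightarrow> bool" where
  "abelian S \<longleftrightarrow> subalgebra S \<and> commuting S S"

text \<open>
  Codimension 1 means that there is a one-dimensional linear complement. The library's \<open>dim\<close> is 0
  on infinite-dimensional spaces, so \<open>dim C = 1\<close> does force \<open>C\<close> to be one-dimensional.
\<close>

definition codim_one :: "'a set \<Rightarrow> 'a set \<Rightarrow> bool" where
  "codim_one A S \<longleftrightarrow>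
     subspace A \<and> (\<exists>C. subspace C \<and> dim C = 1 \<and> A \<inter> C = {0} \<and> S = A + C)"

definition almost_abelian :: "'a set \<Rightarrow> bool" where
  "almost_abelian S \<longleftrightarrow>
     subalgebra S \<and> \<not> abelian S \<and> (\<exists>A. abelian A \<and> codim_one A S)"

definition lie_direct_sum :: "'a set \<Rightarrow> 'a set \<Rightarrow> 'a set \<Rightarrow> bool" where
  "lie_direct_sum S A B \<longleftrightarrow>
     subalgebra A \<and> subalgebra B \<and> commuting A B \<and> A \<inter> B = {0} \<and> S = A + B"

definition decomposable :: "'a set \<Rightarrow> bool" where
  "decomposable S \<longleftrightarrow> (\<exists>A B. A \<noteq> {0} \<and> B \<noteq> {0} \<and> lie_direct_sum S A B)"

definition center :: "'a set \<Rightarrow> 'a set" where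
  "center S = {z \<in> S. \<forall>x\<in>S. bracket z x = 0}"

definition derived :: "'a set \<Rightarrow> 'a set" where
  "derived S = span {bracket x y | x y. x \<in> S \<and> y \<in> S}"

end

text \<open>
  Maps between subspaces are total functions on the ambient types; their values outside the
  domain \<open>S\<close> are irrelevant.
\<close>

definition linear_map_on ::
  "('f \<Rightarrow> 'a::ab_group_add \<Rightarrow> 'a) \<Rightarrow> ('f \<Rightarrow> 'b::ab_group_add \<Rightarrow> 'b) \<Rightarrow>
   'a set \<Rightarrow> 'b set \<Rightarrow> ('a \<Rightarrow> 'b) \<Rightarrow> bool" where
  "linear_map_on scale scale' S T f \<longleftrightarrow>
     f ` S \<subseteq> T \<and>
     (\<forall>x\<in>S. \<forall>y\<in>S. f (x + y) = f x + f y) \<and>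
     (\<forall>c. \<forall>x\<in>S. f (scale c x) = scale' c (f x))"

definition lie_hom_on ::
  "('f::field \<Rightarrow> 'a::ab_group_add \<Rightarrow> 'a) \<Rightarrow> ('a \<Rightarrow> 'a \<Rightarrow> 'a) \<Rightarrow>
   ('f \<Rightarrow> 'b::ab_group_add \<Rightarrow> 'b) \<Rightarrow> ('b \<Rightarrow> 'b \<Rightarrow> 'b) \<Rightarrow>
   'a set \<Rightarrow> 'b set \<Rightarrow> ('a \<Rightarrow> 'b) \<Rightarrow> bool" where
  "lie_hom_on scale br scale' br' S T f \<longleftrightarrow>
     lie_algebra.subalgebra scale br S \<and> lie_algebra.subalgebra scale' br' T \<and>
     linear_map_on scale scale' S T f \<and>
     (\<forall>x\<in>S. \<forall>y\<in>S. f (br x y) = br' (f x) (f y))"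

end

theory Submission
  imports Defs
begin

text \<open>
  A surjection carries the central summand \<open>W\<close> into the centre of the target, and projecting to
  \<open>L0'\<close> gives the claim about \<open>\<phi>01\<close>. Since \<open>L0'\<close> and \<open>W'\<close> commute and \<open>W'\<close> is Abelian, the bracket
  of \<open>\<phi> X\<close> and \<open>\<phi> Y\<close>, for \<open>X\<close> and \<open>Y\<close> in \<open>L0\<close>, lies in \<open>L0'\<close> and sees only their \<open>L0'\<close>-components; comparing
  components shows that \<open>\<phi>00\<close> preserves brackets and that \<open>\<phi>10\<close> kills them.

  The substance is the surjectivity of \<open>\<phi>00\<close>. Surjectivity of \<open>\<phi>\<close> only gives
  \<open>L0' = \<phi>00 L0 + \<phi>01 W\<close>. But \<open>\<phi>01 W\<close> is central, so it contributes nothing to brackets, and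
  hence \<open>[L0', L0']\<close> is already contained in \<open>\<phi>00 L0\<close>. A central vector outside the derived algebra
  would span a direct factor, so indecomposability forces the centre of \<open>L0'\<close> into \<open>[L0', L0']\<close>
  (\<open>center_subset_derived_if_indecomposable\<close>), while for \<open>L0' = {0}\<close> the centre is zero. Therefore \<open>\<phi>01 W\<close>, too, lies in \<open>\<phi>00 L0\<close>.
\<close>

section \<open>Subalgebras and direct sums\<close>

context lie_algebra
begin

lemma bracket_zero_left [simp]: "bracket 0 x = 0"
  using bracket_scale_left[of 0 0 x] by simp

lemma bracket_anticomm: "bracket x y = - bracket y x"
proof -
  have "bracket (x + y) (x + y) = bracket x y + bracket y x"
    unfolding bracket_add_left bracket_add_right by (simp add: bracket_self)
  then show ?thesis
    by (metis bracket_self eq_neg_iff_add_eq_0)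
qed

lemma commuting_sym: "commuting A B \<Longrightarrow> commuting B A"
  unfolding commuting_def by (metis bracket_anticomm neg_equal_0_iff_equal)

lemma subalgebra_center:
  assumes "subalgebra S"
  shows "subalgebra (center S)"
  using assms
  unfolding subalgebra_def center_def subspace_def
  by (auto simp: bracket_add_left bracket_scale_left)

lemma subalgebra_if_derived_subset:
  assumes "subspace H" "H \<subseteq> S" "derived S \<subseteq> H"
  shows "subalgebra H"
proof -
  have "bracket x y \<in> derived S" if "x \<in> H" "y \<in> H" for x y
    unfolding derived_def using that assms(2) by (intro span_base) blast
  then show ?thesis
    using assms unfolding subalgebra_def by blast
qed

lemma derived_subset:
  assumes "subspace H" "\<And>x y. x \<in> S \<Longrightarrow> y \<in> S \<Longrightarrow> bracket x y \<in> H"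
  shows "derived S \<subseteq> H"
  unfolding derived_def using assms by (intro span_minimal) blast+

lemma lie_direct_sum_unique:
  assumes "lie_direct_sum S A B" "a \<in> A" "a' \<in> A" "b \<in> B" "b' \<in> B" "a + b = a' + b'"
  shows "a = a' \<and> b = b'"
proof -
  have "a - a' = b' - b"
    using assms(6) by (simp add: algebra_simps)
  moreover have "a - a' \<in> A" "b' - b \<in> B"
    using assms(1-5) unfolding lie_direct_sum_def subalgebra_def by (auto intro: subspace_diff)
  ultimately have "a - a' \<in> A \<inter> B"
    by simp
  then have "a - a' = 0"
    using assms(1) unfolding lie_direct_sum_def by auto
  then show ?thesis
    using \<open>a - a' = b' - b\<close> by simp
qed

section \<open>The centre of an indecomposable algebra\<close>

text \<open>
  \<open>H\<close> is spanned by all vectors but \<open>z\<close> of a basis of \<open>S\<close> that extends a basis of \<open>D\<close> together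
  with \<open>z\<close>.
\<close>

lemma subspace_has_hyperplane:
  assumes "subspace D" "subspace S" "D \<subseteq> S" "z \<in> S" "z \<notin> D"
  obtains H where "subspace H" "D \<subseteq> H" "H \<subseteq> S" "z \<notin> H" "S = H + span {z}"
proof -
  obtain B where B: "B \<subseteq> D" "independent B" "D \<subseteq> span B"
    using basis_exists by metis
  have "span B \<subseteq> D"
    using B assms(1) by (simp add: span_minimal)
  then have "z \<notin> span B"
    using assms(5) by blast
  then have "independent (insert z B)"
    using B(2) independent_insertI by blast
  moreover have "insert z B \<subseteq> S"
    using B(1) assms by blast
  ultimately obtain C where C: "insert z B \<subseteq> C" "C \<subseteq> S" "independent C" "S \<subseteq> span C"
    using maximal_independent_subset_extend by metis
  have zC: "insert z (C - {z}) = C"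
    using C(1) by blast
  have "z \<notin> B"
    using \<open>z \<notin> span B\<close> span_base by blast
  then have "span B \<subseteq> span (C - {z})"
    using C(1) by (intro span_mono) blast
  moreover have "z \<notin> span (C - {z})"
    using C(1,3) unfolding dependent_def by blast
  moreover have "span (C - {z}) \<subseteq> S"
    using C(2) assms(2) by (intro span_minimal) auto
  moreover have "S = span (C - {z}) + span {z}"
  proof -
    have "S = span ((C - {z}) \<union> {z})"
      using C zC assms(2) by (metis Un_insert_right span_minimal subset_antisym sup_bot_right)
    then show ?thesis
      unfolding span_Un set_plus_def by auto
  qed
  ultimately show ?thesis
    using B(3) that[of "span (C - {z})"] by (meson order_trans subspace_span)
qed

text \<open>
  A hyperplane that contains the derived algebra is an ideal. If a central \<open>z\<close> lies outside the
  derived algebra, some such hyperplane avoids \<open>z\<close> and is a complement of \<open>span {z}\<close>; both factors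
  are nonzero because a one-dimensional algebra is Abelian.
\<close>

lemma center_subset_derived_if_indecomposable:
  assumes S: "subalgebra S" and "\<not> abelian S" and "\<not> decomposable S"
  shows "center S \<subseteq> derived S"
proof
  fix z
  assume z: "z \<in> center S"
  show "z \<in> derived S"
  proof (rule ccontr)
    assume nz: "z \<notin> derived S"
    have subS: "subspace S"
      using S by (simp add: subalgebra_def)
    have zS: "z \<in> S"
      using z by (simp add: center_def)
    have "derived S \<subseteq> S"
      using S subS by (intro derived_subset) (auto simp: subalgebra_def)
    then obtain H where H: "subspace H" "derived S \<subseteq> H" "H \<subseteq> S" "z \<notin> H" "S = H + span {z}"
      using subspace_has_hyperplane[OF _ subS _ zS nz] unfolding derived_def by auto
    have span_center: "span {z} \<subseteq> center S"
      using z subalgebra_center[OF S] by (intro span_minimal) (auto simp: subalgebra_def)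
    have central: "bracket x y = 0" if "x \<in> span {z}" "y \<in> S" for x y
      using span_center that unfolding center_def by blast
    have "subalgebra H"
      using H subalgebra_if_derived_subset by blast
    moreover have span_abelian: "abelian (span {z})"
    proof -
      have "span {z} \<subseteq> S"
        using span_center unfolding center_def by blast
      then have "bracket x y = 0" if "x \<in> span {z}" "y \<in> span {z}" for x y
        using central that by blast
      then show ?thesis
        by (simp add: abelian_def subalgebra_def commuting_def span_zero)
    qed
    moreover have "commuting H (span {z})"
    proof (rule commuting_sym)
      show "commuting (span {z}) H"
        using central H(3) unfolding commuting_def by blast
    qed
    moreover have "H \<inter> span {z} = {0}"
    proof -
      have "x = 0" if x: "x \<in> H" "x \<in> span {z}" for x
      proof -
        obtain c where c: "x = scale c z"
          using x(2) by (auto simp: span_singleton)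
        have "c = 0"
        proof (rule ccontr)
          assume "c \<noteq> 0"
          then have "z = scale (inverse c) x"
            by (simp add: c)
          then show False
            using H(1,4) x(1) subspace_scale by metis
        qed
        then show ?thesis
          by (simp add: c)
      qed
      then show ?thesis
        using subspace_0[OF H(1)] span_zero by blast
    qed
    ultimately have "lie_direct_sum S H (span {z})"
      using H(5) by (simp add: lie_direct_sum_def abelian_def)
    moreover have "H \<noteq> {0}"
    proof
      assume "H = {0}"
      then have "S = span {z}"
        using H(5) by (auto simp: set_plus_def)
      then show False
        using span_abelian \<open>\<not> abelian S\<close> by simp
    qed
    moreover have "span {z} \<noteq> {0}"
    proof -
      have "z \<noteq> 0"
        using H(4) subspace_0[OF H(1)] by auto
      moreover have "z \<in> span {z}"
        by (simp add: span_base)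
      ultimately show ?thesis
        by blast
    qed
    ultimately show False
      using \<open>\<not> decomposable S\<close> unfolding decomposable_def by blast
  qed
qed

end

section \<open>Linear maps between subspaces\<close>

lemma linear_map_on_zero:
  assumes "vector_space scale" "vector_space scale'" "linear_map_on scale scale' S T f" "0 \<in> S"
  shows "f 0 = 0"
proof -
  interpret V: vector_space scale by fact
  interpret V': vector_space scale' by fact
  have "f (scale 0 0) = scale' 0 (f 0)"
    using assms(3,4) unfolding linear_map_on_def by blast
  then show ?thesis
    by simp
qed

lemma subspace_linear_image:
  assumes "vector_space scale" "vector_space scale'" "linear_map_on scale scale' S T f"
    and "module.subspace scale S"
  shows "module.subspace scale' (f ` S)"
proof -
  interpret V: vector_space scale by fact
  interpret V': vector_space scale' by fact
  have add: "f x + f y = f (x + y)" if "x \<in> S" "y \<in> S" for x y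
    using assms(3) that by (simp add: linear_map_on_def)
  have scl: "scale' c (f x) = f (scale c x)" if "x \<in> S" for c x
    using assms(3) that by (simp add: linear_map_on_def)
  have zero: "0 \<in> S"
    using assms(4) by (rule V.subspace_0)
  show ?thesis
  proof (rule V'.subspaceI)
    show "0 \<in> f ` S"
      using linear_map_on_zero[OF assms(1-3) zero] zero by force
  next
    fix u v
    assume "u \<in> f ` S" "v \<in> f ` S"
    then show "u + v \<in> f ` S"
      using add assms(4) V.subspace_add by auto
  next
    fix c u
    assume "u \<in> f ` S"
    then show "scale' c u \<in> f ` S"
      using scl assms(4) V.subspace_scale by auto
  qed
qed

section \<open>Blocks of a surjective homomorphism\<close>

theorem proposition6:
  fixes scale :: "'f::field \<Rightarrow> 'a::ab_group_add \<Rightarrow> 'a"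
    and br :: "'a \<Rightarrow> 'a \<Rightarrow> 'a"
    and scale' :: "'f \<Rightarrow> 'b::ab_group_add \<Rightarrow> 'b"
    and br' :: "'b \<Rightarrow> 'b \<Rightarrow> 'b"
    and L0 W :: "'a set" and L0' W' :: "'b set"
    and \<phi> \<phi>00 \<phi>01 \<phi>10 \<phi>11 :: "'a \<Rightarrow> 'b"
  assumes "lie_algebra scale br" and "lie_algebra scale' br'"
    and "lie_algebra.almost_abelian scale br UNIV"
    and "lie_algebra.abelian scale' br' UNIV \<or> lie_algebra.almost_abelian scale' br' UNIV"
    and "lie_algebra.lie_direct_sum scale br UNIV L0 W"
    and "lie_algebra.almost_abelian scale br L0" and "\<not> lie_algebra.decomposable scale br L0"
    and "lie_algebra.abelian scale br W"
    and "lie_algebra.lie_direct_sum scale' br' UNIV L0' W'"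
    and "L0' = {0} \<or>
         (lie_algebra.almost_abelian scale' br' L0' \<and> \<not> lie_algebra.decomposable scale' br' L0')"
    and "lie_algebra.abelian scale' br' W'"
    and "lie_hom_on scale br scale' br' UNIV UNIV \<phi>" and "surj \<phi>"
    and "linear_map_on scale scale' L0 L0' \<phi>00"
    and "linear_map_on scale scale' W L0' \<phi>01"
    and "linear_map_on scale scale' L0 W' \<phi>10"
    and "linear_map_on scale scale' W W' \<phi>11"
    and "\<And>X Y. X \<in> L0 \<Longrightarrow> Y \<in> W \<Longrightarrow> \<phi> (X + Y) = (\<phi>00 X + \<phi>01 Y) + (\<phi>10 X + \<phi>11 Y)"
  shows "(lie_hom_on scale br scale' br' L0 L0' \<phi>00 \<and> \<phi>00 ` L0 = L0') \<and>
         lie_hom_on scale br scale' br' W (lie_algebra.center br' L0') \<phi>01 \<and>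
         (lie_hom_on scale br scale' br' L0 W' \<phi>10 \<and>
          lie_algebra.derived scale br L0 \<subseteq> {X \<in> L0. \<phi>10 X = 0}) \<and>
         (lie_hom_on scale br scale' br' W W' \<phi>11 \<and> \<phi>10 ` L0 + \<phi>11 ` W = W')"
proof -
  interpret L: lie_algebra scale br by fact
  interpret L': lie_algebra scale' br' by fact
  note sum = assms(5) and sum' = assms(9)

  have sub: "L.subalgebra L0" "L.subalgebra W" "L'.subalgebra L0'" "L'.subalgebra W'"
    using sum sum' by (auto simp: L.lie_direct_sum_def L'.lie_direct_sum_def)
  note sp = sub[unfolded L.subalgebra_def L'.subalgebra_def]
  have zero: "0 \<in> L0" "0 \<in> W"
    using sp by (auto intro: L.subspace_0)
  have zero': "0 \<in> L0'" "0 \<in> W'"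
    using sp by (auto intro: L'.subspace_0)
  have lin_zero: "\<phi>00 0 = 0" "\<phi>01 0 = 0" "\<phi>10 0 = 0" "\<phi>11 0 = 0"
    using linear_map_on_zero[OF L.vector_space_axioms L'.vector_space_axioms] assms(14-17) zero
    by blast+
  have mem: "X \<in> L0 \<Longrightarrow> \<phi>00 X \<in> L0'" "Y \<in> W \<Longrightarrow> \<phi>01 Y \<in> L0'"
            "X \<in> L0 \<Longrightarrow> \<phi>10 X \<in> W'" "Y \<in> W \<Longrightarrow> \<phi>11 Y \<in> W'" for X Y
    using assms(14-17) by (auto simp: linear_map_on_def)
  have phi0: "\<phi> X = \<phi>00 X + \<phi>10 X" if "X \<in> L0" for X
    using assms(18)[OF that zero(2)] by (simp add: lin_zero)
  have phi1: "\<phi> Y = \<phi>01 Y + \<phi>11 Y" if "Y \<in> W" for Y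
    using assms(18)[OF zero(1) that] by (simp add: lin_zero)
  have phi_br: "\<phi> (br x y) = br' (\<phi> x) (\<phi> y)" for x y
    using assms(12) by (simp add: lie_hom_on_def)
  have brW: "br x y = 0" if "x \<in> W" "y \<in> W" for x y
    using assms(8) that by (simp add: L.abelian_def L.commuting_def)
  have brW': "br' x y = 0" if "x \<in> W'" "y \<in> W'" for x y
    using assms(11) that by (simp add: L'.abelian_def L'.commuting_def)
  have comm: "br x y = 0" if "x \<in> W" "y \<in> L0" for x y
    using sum L.commuting_sym that unfolding L.lie_direct_sum_def L.commuting_def by blast
  have comm': "br' x y = 0" "br' y x = 0" if "x \<in> L0'" "y \<in> W'" for x y
    using sum' L'.commuting_sym that unfolding L'.lie_direct_sum_def L'.commuting_def by blast+
  have W_central: "br Y u = 0" if Y: "Y \<in> W" for Y u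
  proof -
    have "u \<in> L0 + W"
      using sum unfolding L.lie_direct_sum_def by blast
    then obtain a b where "u = a + b" "a \<in> L0" "b \<in> W"
      by (rule set_plus_elim)
    then show ?thesis
      by (simp add: L.bracket_add_right brW comm Y)
  qed

  have components: "\<exists>X\<in>L0. \<exists>Y\<in>W. x' = \<phi>00 X + \<phi>01 Y \<and> w' = \<phi>10 X + \<phi>11 Y"
    if x'w': "x' \<in> L0'" "w' \<in> W'" for x' w'
  proof -
    obtain u where u: "\<phi> u = x' + w'"
      using assms(13) by (metis surjD)
    have "u \<in> L0 + W"
      using sum unfolding L.lie_direct_sum_def by blast
    then obtain X Y where XY: "u = X + Y" "X \<in> L0" "Y \<in> W"
      by (rule set_plus_elim)
    have "x' + w' = (\<phi>00 X + \<phi>01 Y) + (\<phi>10 X + \<phi>11 Y)"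
      using u assms(18)[OF XY(2,3)] XY(1) by simp
    moreover have "\<phi>00 X + \<phi>01 Y \<in> L0'" "\<phi>10 X + \<phi>11 Y \<in> W'"
      using sp mem XY by (auto intro: L'.subspace_add)
    ultimately have "x' = \<phi>00 X + \<phi>01 Y \<and> w' = \<phi>10 X + \<phi>11 Y"
      using L'.lie_direct_sum_unique[OF sum'] x'w' by blast
    then show ?thesis
      using XY by blast
  qed

  have brackets: "\<phi>00 (br X Y) = br' (\<phi>00 X) (\<phi>00 Y) \<and> \<phi>10 (br X Y) = 0"
    if XY: "X \<in> L0" "Y \<in> L0" for X Y
  proof -
    have br_mem: "br X Y \<in> L0"
      using sp XY by blast
    have "\<phi>00 (br X Y) + \<phi>10 (br X Y) = br' (\<phi>00 X + \<phi>10 X) (\<phi>00 Y + \<phi>10 Y)"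
      using phi_br[of X Y] phi0 br_mem XY by simp
    also have "\<dots> = br' (\<phi>00 X) (\<phi>00 Y) + 0"
      using XY mem by (simp add: L'.bracket_add_left L'.bracket_add_right comm' brW')
    finally have "\<phi>00 (br X Y) + \<phi>10 (br X Y) = br' (\<phi>00 X) (\<phi>00 Y) + 0" .
    moreover have "br' (\<phi>00 X) (\<phi>00 Y) \<in> L0'"
      using sp(3) mem(1) XY by simp
    ultimately show ?thesis
      using L'.lie_direct_sum_unique[OF sum' mem(1)[OF br_mem] _ mem(3)[OF br_mem] zero'(2)]
      by blast
  qed

  have phi01_center: "\<phi>01 Y \<in> L'.center L0'" if Y: "Y \<in> W" for Y
  proof -
    have "br' (\<phi>01 Y) x' = 0" if x': "x' \<in> L0'" for x'
    proof -
      obtain u where u: "\<phi> u = x'"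
        using assms(13) by (metis surjD)
      have "\<phi> 0 = 0"
        using phi0[OF zero(1)] lin_zero by simp
      then have "0 = br' (\<phi> Y) (\<phi> u)"
        using phi_br[of Y u] W_central[OF Y] by simp
      also have "\<dots> = br' (\<phi>01 Y) x'"
        using Y x' mem by (simp add: u phi1 L'.bracket_add_left comm')
      finally show ?thesis
        by simp
    qed
    then show ?thesis
      using mem Y by (simp add: L'.center_def)
  qed

  have image_sub: "L'.subspace (\<phi>00 ` L0)"
    using subspace_linear_image[OF L.vector_space_axioms L'.vector_space_axioms assms(14)] sp
    by blast

  \<comment> \<open>The central summands \<open>\<phi>01 Y\<close> drop out of every bracket of elements of \<open>L0'\<close>.\<close>
  have derived_image: "L'.derived L0' \<subseteq> \<phi>00 ` L0"
  proof (rule L'.derived_subset[OF image_sub])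
    fix x y
    assume x: "x \<in> L0'" and y: "y \<in> L0'"
    obtain X1 Y1 X2 Y2
      where 1: "X1 \<in> L0" "Y1 \<in> W" "x = \<phi>00 X1 + \<phi>01 Y1"
        and 2: "X2 \<in> L0" "Y2 \<in> W" "y = \<phi>00 X2 + \<phi>01 Y2"
      using components[OF x zero'(2)] components[OF y zero'(2)] by blast
    have central: "br' (\<phi>01 Y) u = 0" "br' u (\<phi>01 Y) = 0" if "Y \<in> W" "u \<in> L0'" for Y u
      using phi01_center[OF that(1)] that(2) L'.bracket_anticomm[of u "\<phi>01 Y"]
      by (auto simp: L'.center_def)
    have "br' x y = br' (\<phi>00 X1) (\<phi>00 X2)"
      using 1 2 mem by (simp add: L'.bracket_add_left L'.bracket_add_right central)
    also have "\<dots> = \<phi>00 (br X1 X2)"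
      using brackets 1 2 by simp
    finally show "br' x y \<in> \<phi>00 ` L0"
      using 1 2 sp by blast
  qed

  have center_image: "L'.center L0' \<subseteq> \<phi>00 ` L0"
    using assms(10)
  proof
    assume "L0' = {0}"
    then show ?thesis
      using L'.subspace_0[OF image_sub] by (auto simp: L'.center_def)
  next
    assume "L'.almost_abelian L0' \<and> \<not> L'.decomposable L0'"
    then have "L'.center L0' \<subseteq> L'.derived L0'"
      by (intro L'.center_subset_derived_if_indecomposable) (auto simp: L'.almost_abelian_def)
    then show ?thesis
      using derived_image by blast
  qed

  have onto0: "\<phi>00 ` L0 = L0'"
  proof
    show "L0' \<subseteq> \<phi>00 ` L0"
    proof
      fix x'
      assume "x' \<in> L0'"
      then obtain X Y where XY: "X \<in> L0" "Y \<in> W" "x' = \<phi>00 X + \<phi>01 Y"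
        using components zero'(2) by blast
      have "\<phi>01 Y \<in> \<phi>00 ` L0"
        using phi01_center[OF XY(2)] center_image by blast
      then show "x' \<in> \<phi>00 ` L0"
        unfolding XY(3) using XY(1) by (intro L'.subspace_add[OF image_sub] imageI)
    qed
  qed (use mem in blast)

  have onto1: "\<phi>10 ` L0 + \<phi>11 ` W = W'"
  proof
    show "\<phi>10 ` L0 + \<phi>11 ` W \<subseteq> W'"
      using mem(3,4) sp(4) by (auto elim!: set_plus_elim intro: L'.subspace_add)
    show "W' \<subseteq> \<phi>10 ` L0 + \<phi>11 ` W"
    proof
      fix w'
      assume "w' \<in> W'"
      then obtain X Y where "X \<in> L0" "Y \<in> W" "w' = \<phi>10 X + \<phi>11 Y"
        using components zero'(1) by blast
      then show "w' \<in> \<phi>10 ` L0 + \<phi>11 ` W"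
        by (auto intro: set_plus_intro)
    qed
  qed

  have ker: "L.derived L0 \<subseteq> {X \<in> L0. \<phi>10 X = 0}"
  proof (rule L.derived_subset)
    show "L.subspace {X \<in> L0. \<phi>10 X = 0}"
      using sp assms(16) lin_zero by (auto simp: L.subspace_def linear_map_on_def)
  qed (use brackets sp in blast)

  have "lie_hom_on scale br scale' br' L0 L0' \<phi>00"
    using sub assms(14) brackets by (simp add: lie_hom_on_def)
  moreover have "lie_hom_on scale br scale' br' W (L'.center L0') \<phi>01"
  proof -
    have "linear_map_on scale scale' W (L'.center L0') \<phi>01"
      using assms(15) phi01_center by (auto simp: linear_map_on_def)
    moreover have "\<phi>01 (br x y) = br' (\<phi>01 x) (\<phi>01 y)" if "x \<in> W" "y \<in> W" for x y
      using that phi01_center[OF that(1)] mem by (simp add: brW lin_zero L'.center_def)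
    ultimately show ?thesis
      using sub L'.subalgebra_center by (simp add: lie_hom_on_def)
  qed
  moreover have "lie_hom_on scale br scale' br' L0 W' \<phi>10"
    using sub assms(16) brackets brW' mem by (simp add: lie_hom_on_def)
  moreover have "lie_hom_on scale br scale' br' W W' \<phi>11"
    using sub assms(17) brW brW' mem lin_zero by (simp add: lie_hom_on_def)
  ultimately show ?thesis
    using onto0 onto1 ker by blast
qed

end
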